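(* Let $H$ be a hypergraph. Then $$T_{\mathrm{HG}}(H;x,y)=(x-1)^{-\kappa(H)}(y-1)^{-v(H)}\,Z_{\mathrm{RC}}\big(H;(x-1)(y-1),\,y-1\big)$$ (as an identity of rational functions in $x,y$), and $$Z_{\mathrm{RC}}(H;q,v)=q^{\kappa(H)}\,v^{\,v(H)-\kappa(H)}\,T_{\mathrm{HG}}\!\left(H;1+\frac{q}{v},\,1+v\right)$$ for $v\neq0$. (Here $v$ as a variable is distinct from the vertex count $v(H)$.)
   Context: A hypergraph is a pair $H=(V,E)$ where $V$ is a finite set and $E$ is a finite multiset (parallel hyperedges are allowed and treated as distinct elements of $E$) of multisets of elements of $V$, called hyperedges. For $e\in E$, $d(e)$ is the size of $e$ counted with multiplicity; it is always assumed that $d(e)>1$. Write $v(H)=|V|$. $\kappa(H)$ is the number of connected components of the bipartite incidence graph with vertex classes $V$ and $E$, in which $u\in V$ and $e\in E$ are joined by as many edges as the multiplicity of $u$ in $e$. For $A\subseteq E$ let $\kappa(A)=\kappa((V,A))$, $d(A)=\sum_{e\in A}d(e)$, and $|A|$ is the number of hyperedges in $A$. Hypergraph Tutte polynomial: $T_{\mathrm{HG}}(H;x,y)=\sum_{A\subseteq E}(x-1)^{\kappa(A)-\kappa(H)}(y-1)^{d(A)-|A|-v(H)+\kappa(A)}$. Degree-dependent hypergraph random cluster partition function: $Z_{\mathrm{RC}}(H;q,v)=\sum_{A\subseteq E}q^{\kappa(A)}\prod_{e\in A}v^{d(e)-1}$. *)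

theory Defs
  imports
    "HOL-Library.Multiset"
    "HOL-Computational_Algebra.Polynomial_Factorial"
    "Graph_Theory.Digraph_Component"
begin

text \<open>
  The multiset of hyperedges is given as a finite set of labels together with a map sending each
  label to the multiset of its vertices. Parallel hyperedges are distinct labels with the same
  image, so that a sub-multiset of hyperedges is a set of labels.
\<close>

record ('v, 'e) hypergraph =
  vertices :: "'v set"
  hyperedges :: "'e set"
  ends :: "'e \<Rightarrow> 'v multiset"

definition hyperdegree :: "('v, 'e) hypergraph \<Rightarrow> 'e \<Rightarrow> nat" where
  "hyperdegree H e = size (ends H e)"

definition is_hypergraph :: "('v, 'e) hypergraph \<Rightarrow> bool" where
  "is_hypergraph H \<longleftrightarrow>
     finite (vertices H) \<and> finite (hyperedges H) \<and>
     (\<forall>e \<in> hyperedges H. set_mset (ends H e) \<subseteq> vertices H \<and> hyperdegree H e > 1)"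

text \<open>
  The arcs \<open>(u, e, i)\<close> with \<open>i < count (ends H e) u\<close> are the parallel edges between \<open>u\<close> and \<open>e\<close>.
  Their orientation from \<open>u\<close> to \<open>e\<close> is immaterial: \<^const>\<open>connected\<close> refers to the underlying
  undirected graph and holds only for graphs with at least one vertex.
\<close>

definition incidence_graph ::
    "('v, 'e) hypergraph \<Rightarrow> ('v + 'e, 'v \<times> 'e \<times> nat) pre_digraph" where
  "incidence_graph H =
     \<lparr>verts = Inl ` vertices H \<union> Inr ` hyperedges H,
      arcs = {(u, e, i). e \<in> hyperedges H \<and> i < count (ends H e) u},
      tail = (\<lambda>(u, e, i). Inl u),
      head = (\<lambda>(u, e, i). Inr e)\<rparr>"

definition num_components :: "('a, 'b) pre_digraph \<Rightarrow> nat" where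
  "num_components G = card {C. pre_digraph.max_subgraph G connected C}"

definition kappa :: "('v, 'e) hypergraph \<Rightarrow> nat" where
  "kappa H = num_components (incidence_graph H)"

definition kappa_of :: "('v, 'e) hypergraph \<Rightarrow> 'e set \<Rightarrow> nat" where
  "kappa_of H A = kappa (H\<lparr>hyperedges := A\<rparr>)"

definition total_degree :: "('v, 'e) hypergraph \<Rightarrow> 'e set \<Rightarrow> nat" where
  "total_degree H A = (\<Sum>e\<in>A. hyperdegree H e)"

definition T_HG :: "('v, 'e) hypergraph \<Rightarrow> 'k::field \<Rightarrow> 'k \<Rightarrow> 'k" where
  "T_HG H x y =
     (\<Sum>A\<in>Pow (hyperedges H).
        (x - 1) powi (int (kappa_of H A) - int (kappa H)) *
        (y - 1) powi (int (total_degree H A) - int (card A) - int (card (vertices H))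
                      + int (kappa_of H A)))"

definition Z_RC :: "('v, 'e) hypergraph \<Rightarrow> 'k::field \<Rightarrow> 'k \<Rightarrow> 'k" where
  "Z_RC H q v =
     (\<Sum>A\<in>Pow (hyperedges H). q ^ kappa_of H A * (\<Prod>e\<in>A. v ^ (hyperdegree H e - 1)))"

text \<open>The two indeterminates of the field of rational functions in two variables over \<open>'k\<close>.\<close>

definition rat_X :: "'k::field poly poly fract" where
  "rat_X = to_fract [:[:0, 1:]:]"

definition rat_Y :: "'k::field poly poly fract" where
  "rat_Y = to_fract [:0, 1:]"

end

theory Submission
  imports Defs
begin

text \<open>
  Both identities hold summand by summand, by adding exponents. The only delicate point is the
  second identity at \<open>q = 0\<close>, where the factor \<open>q\<^sup>\<kappa>\<^sup>(\<^sup>H\<^sup>)\<close> cannot be cancelled: if \<open>\<kappa>(H) > 0\<close> then both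
  sides vanish, provided that \<open>\<kappa>(A) > 0\<close> for all \<open>A\<close>. So it suffices to know that a finite nonempty
  graph has at least one component and that only the empty hypergraph has none.
\<close>

text \<open>Provides a first connected subgraph from which a maximal one can be sought. The maps
  \<open>t\<close> and \<open>h\<close> are arbitrary, so that those of an ambient graph can be
  inserted.\<close>

lemma connected_single_vertex:
  "connected \<lparr>verts = {u}, arcs = {}, tail = t, head = h\<rparr>"
proof -
  have "u \<rightarrow>\<^sup>*\<^bsub>with_proj \<lparr>pverts = {u}, parcs = {}\<rparr>\<^esub> u"
    by (simp add: reachable_def rtrancl_on.rtrancl_on_refl)
  then show ?thesis
    by (simp add: connected_def mk_symmetric_def strongly_connected_def)
qed

text \<open>Compatibility fixes \<open>tail\<close> and \<open>head\<close>, so a subgraph is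
  determined by its vertex set and its arc set.\<close>

lemma (in fin_digraph) finite_subgraphs: "finite {C. subgraph C G}"
proof (rule finite_subset)
  show "{C. subgraph C G} \<subseteq>
    (\<lambda>(V, E). \<lparr>verts = V, arcs = E, tail = tail G, head = head G\<rparr>) ` (Pow (verts G) \<times> Pow (arcs G))"
  proof
    fix C assume "C \<in> {C. subgraph C G}"
    then have "C = \<lparr>verts = verts C, arcs = arcs C, tail = tail G, head = head G\<rparr>"
        and "(verts C, arcs C) \<in> Pow (verts G) \<times> Pow (arcs G)"
      by (auto simp: subgraph_def compatible_def)
    then show "C \<in> (\<lambda>(V, E). \<lparr>verts = V, arcs = E, tail = tail G, head = head G\<rparr>) `
        (Pow (verts G) \<times> Pow (arcs G))"
      by (metis (no_types, lifting) case_prod_conv image_eqI)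
  qed
qed simp

text \<open>A subgraph with \<open>P\<close> that has the largest number of vertices plus arcs is
  also maximal for inclusion.\<close>

lemma (in fin_digraph) max_subgraph_exists:
  assumes "subgraph C G" and "P C"
  shows "\<exists>M. max_subgraph P M"
proof -
  let ?size = "\<lambda>K. card (verts K) + card (arcs K)"
  have size_le: "?size K \<le> ?size G" if "subgraph K G" for K
    using that by (auto simp: subgraph_def intro!: add_mono card_mono)
  have "\<exists>M. (subgraph M G \<and> P M) \<and> (\<forall>K. subgraph K G \<and> P K \<longrightarrow> ?size K \<le> ?size M)"
    \<comment> \<open>\<open>Suc\<close> makes the bound \<open>?size G\<close> strict.\<close>
    by (rule ex_has_greatest_nat[where k = C and b = "Suc (?size G)"])
      (use assms size_le in \<open>simp_all add: less_Suc_eq_le\<close>)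
  then obtain M where M: "subgraph M G" "P M"
      and greatest: "\<And>K. subgraph K G \<Longrightarrow> P K \<Longrightarrow> ?size K \<le> ?size M"
    by auto
  have "K = M" if "subgraph M K" "subgraph K G" "P K" for K
  proof -
    have sub: "verts M \<subseteq> verts K" "arcs M \<subseteq> arcs K"
      and ends: "tail K = tail M" "head K = head M"
      using that(1) by (auto simp: subgraph_def compatible_def)
    have fin: "finite (verts K)" "finite (arcs K)"
      using that(2) by (auto simp: subgraph_def intro: finite_subset)
    have "card (verts M) \<le> card (verts K)" "card (arcs M) \<le> card (arcs K)"
      using sub fin by (auto intro: card_mono)
    \<comment> \<open>Neither cardinality decreases from \<open>M\<close> to \<open>K\<close> and
      their sum does not grow, so both are equal.\<close>
    with greatest[OF that(2,3)]
    have "card (verts M) = card (verts K)" "card (arcs M) = card (arcs K)"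
      by linarith+
    then have "verts M = verts K" "arcs M = arcs K"
      using card_subset_eq[OF fin(1) sub(1)] card_subset_eq[OF fin(2) sub(2)] by simp_all
    with ends show "K = M" by simp
  qed
  with M have "max_subgraph P M"
    by (intro max_subgraphI) blast+
  then show ?thesis ..
qed

text \<open>A single vertex is a connected subgraph, so a maximal connected one exists. Finiteness
  matters as well: \<open>card\<close> of an infinite set would be 0.\<close>

lemma (in fin_digraph) num_components_pos:
  assumes "verts G \<noteq> {}"
  shows "num_components G > 0"
proof -
  obtain u where "u \<in> verts G" using assms by blast
  then have "subgraph \<lparr>verts = {u}, arcs = {}, tail = tail G, head = head G\<rparr> G"
    using wf_digraph_axioms by (auto simp: subgraph_def compatible_def wf_digraph_def)
  then have "\<exists>C. max_subgraph connected C"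
    using connected_single_vertex by (rule max_subgraph_exists)
  moreover have "finite {C. max_subgraph connected C}"
    by (rule finite_subset[OF _ finite_subgraphs]) (auto simp: max_subgraph_def)
  ultimately show ?thesis
    by (auto simp: num_components_def card_gt_0_iff)
qed

lemma fin_digraph_incidence_graph:
  assumes "is_hypergraph H"
  shows "fin_digraph (incidence_graph H)"
proof
  have "arcs (incidence_graph H) \<subseteq>
      (\<Union>e\<in>hyperedges H. \<Union>u\<in>vertices H. (\<lambda>i. (u, e, i)) ` {..<count (ends H e) u})"
  proof clarify
    fix u e i assume "(u, e, i) \<in> arcs (incidence_graph H)"
    then have *: "e \<in> hyperedges H" "i < count (ends H e) u"
      by (auto simp: incidence_graph_def)
    then have "u \<in># ends H e"
      by (metis less_nat_zero_code not_in_iff)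
    with * assms show "(u, e, i) \<in>
        (\<Union>e\<in>hyperedges H. \<Union>u\<in>vertices H. (\<lambda>i. (u, e, i)) ` {..<count (ends H e) u})"
      by (auto simp: is_hypergraph_def)
  qed
  then show "finite (arcs (incidence_graph H))"
    by (rule finite_subset) (use assms in \<open>auto simp: is_hypergraph_def\<close>)
  show "finite (verts (incidence_graph H))"
    using assms by (auto simp: is_hypergraph_def incidence_graph_def)
next
  fix a assume "a \<in> arcs (incidence_graph H)"
  then obtain u e i where a: "a = (u, e, i)" "e \<in> hyperedges H" "i < count (ends H e) u"
    by (auto simp: incidence_graph_def)
  then have "u \<in># ends H e"
    by (metis less_nat_zero_code not_in_iff)
  with a assms show "tail (incidence_graph H) a \<in> verts (incidence_graph H)"
      "head (incidence_graph H) a \<in> verts (incidence_graph H)"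
    by (auto simp: incidence_graph_def is_hypergraph_def)
qed

lemma is_hypergraph_restrict:
  assumes "is_hypergraph H" and "A \<subseteq> hyperedges H"
  shows "is_hypergraph (H\<lparr>hyperedges := A\<rparr>)"
  using assms by (auto simp: is_hypergraph_def hyperdegree_def intro: finite_subset)

lemma kappa_pos:
  assumes "is_hypergraph H" and "vertices H \<noteq> {}"
  shows "kappa H > 0"
  unfolding kappa_def
  using fin_digraph.num_components_pos[OF fin_digraph_incidence_graph[OF assms(1)]] assms(2)
  by (auto simp: incidence_graph_def)

text \<open>Without vertices only the empty hyperedge is possible, and the degree condition excludes
  it.\<close>

lemma hyperedges_empty_if_vertices_empty:
  assumes "is_hypergraph H" and "vertices H = {}"
  shows "hyperedges H = {}"
proof (rule equals0I)
  fix e assume "e \<in> hyperedges H"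
  with assms have "set_mset (ends H e) = {}" "size (ends H e) > 1"
    unfolding is_hypergraph_def hyperdegree_def by auto
  then show False by simp
qed

lemma kappa_of_eq_0:
  assumes "is_hypergraph H" and "A \<subseteq> hyperedges H" and "kappa_of H A = 0"
  shows "kappa H = 0"
proof -
  have "vertices H = {}"
    using kappa_pos[OF is_hypergraph_restrict[OF assms(1,2)]] assms(3)
    by (auto simp: kappa_of_def)
  then have "hyperedges H = {}"
    by (rule hyperedges_empty_if_vertices_empty[OF assms(1)])
  with assms(2) have "H\<lparr>hyperedges := A\<rparr> = H" by simp
  with assms(3) show ?thesis by (simp add: kappa_of_def)
qed

text \<open>Since d(e) > 1, the truncated subtraction is the integer one. The exponent is therefore
  a natural number, and \<open>v = 0\<close> is allowed.\<close>

lemma prod_power_hyperdegree: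
  fixes v :: "'k::field"
  assumes "is_hypergraph H" and "A \<subseteq> hyperedges H"
  shows "(\<Prod>e\<in>A. v ^ (hyperdegree H e - 1)) = v powi (int (total_degree H A) - int (card A))"
proof -
  have "int (\<Sum>e\<in>A. hyperdegree H e - 1) = (\<Sum>e\<in>A. int (hyperdegree H e) - 1)"
    unfolding of_nat_sum
  proof (rule sum.cong[OF refl])
    fix e assume "e \<in> A"
    with assms have "hyperdegree H e > 1" by (auto simp: is_hypergraph_def)
    then show "int (hyperdegree H e - 1) = int (hyperdegree H e) - 1" by simp
  qed
  also have "\<dots> = int (total_degree H A) - int (card A)"
    by (simp add: sum_subtractf total_degree_def)
  finally have "int (\<Sum>e\<in>A. hyperdegree H e - 1) = int (total_degree H A) - int (card A)" .
  moreover have "(\<Prod>e\<in>A. v ^ (hyperdegree H e - 1)) = v powi int (\<Sum>e\<in>A. hyperdegree H e - 1)"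
    unfolding power_int_of_nat by (rule power_sum[symmetric])
  ultimately show ?thesis by simp
qed

text \<open>Both bases are nonzero, so integer exponents add; the power of
  \<open>(x - 1) * (y - 1)\<close> supplies \<kappa>(A) in both exponents.\<close>

lemma T_HG_eq_Z_RC:
  fixes x y :: "'k::field"
  assumes "is_hypergraph H" and "x \<noteq> 1" and "y \<noteq> 1"
  shows "T_HG H x y =
    (x - 1) powi (- int (kappa H)) * (y - 1) powi (- int (card (vertices H))) *
    Z_RC H ((x - 1) * (y - 1)) (y - 1)"
  unfolding T_HG_def Z_RC_def sum_distrib_left
proof (rule sum.cong[OF refl])
  fix A assume "A \<in> Pow (hyperedges H)"
  then have "(\<Prod>e\<in>A. (y - 1) ^ (hyperdegree H e - 1)) =
      (y - 1) powi (int (total_degree H A) - int (card A))"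
    using prod_power_hyperdegree[OF assms(1)] by blast
  with assms(2,3) show "(x - 1) powi (int (kappa_of H A) - int (kappa H)) *
      (y - 1) powi (int (total_degree H A) - int (card A) - int (card (vertices H))
        + int (kappa_of H A)) =
      (x - 1) powi (- int (kappa H)) * (y - 1) powi (- int (card (vertices H))) *
      (((x - 1) * (y - 1)) ^ kappa_of H A * (\<Prod>e\<in>A. (y - 1) ^ (hyperdegree H e - 1)))"
    by (simp add: power_int_add power_int_diff power_int_minus power_mult_distrib
        divide_inverse mult_ac)
qed

lemma Z_RC_eq_T_HG:
  fixes q v :: "'k::field"
  assumes "is_hypergraph H" and "v \<noteq> 0"
  shows "Z_RC H q v =
    q ^ kappa H * v powi (int (card (vertices H)) - int (kappa H)) * T_HG H (1 + q / v) (1 + v)"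
  unfolding T_HG_def Z_RC_def sum_distrib_left
proof (rule sum.cong[OF refl])
  fix A assume "A \<in> Pow (hyperedges H)"
  then have A: "A \<subseteq> hyperedges H" by simp
  \<comment> \<open>The power of \<open>v\<close> clears the denominator of the power of
    \<open>q / v\<close>.\<close>
  have q_cancel: "q ^ kappa_of H A =
      q ^ kappa H * v powi (int (kappa_of H A) - int (kappa H)) *
      (q / v) powi (int (kappa_of H A) - int (kappa H))"
  proof (cases "q = 0")
    case True
    \<comment> \<open>If \<kappa>(H) = 0, both sides are 1 or 0 according to whether \<kappa>(A) =
      0, because \<open>0 powi n = 0\<close> for \<open>n \<noteq> 0\<close>. Otherwise \<kappa>(A)
      > 0 and both sides are 0.\<close>
    then show ?thesis
      using kappa_of_eq_0[OF assms(1) A]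
      by (cases "kappa H = 0"; cases "kappa_of H A = 0") (auto simp: power_0_left)
  next
    case False
    with assms(2) show ?thesis
      by (simp add: power_int_diff power_int_divide_distrib field_simps)
  qed
  have "q ^ kappa_of H A * (\<Prod>e\<in>A. v ^ (hyperdegree H e - 1)) =
      q ^ kappa_of H A * v powi (int (total_degree H A) - int (card A))"
    by (simp only: prod_power_hyperdegree[OF assms(1) A])
  also have "\<dots> = q ^ kappa H * v powi (int (card (vertices H)) - int (kappa H)) *
      ((q / v) powi (int (kappa_of H A) - int (kappa H)) *
       v powi (int (total_degree H A) - int (card A) - int (card (vertices H))
         + int (kappa_of H A)))"
  proof -
    \<comment> \<open>On either side the exponents of \<open>v\<close> add up to d(A) - |A| +
      \<kappa>(A) - \<kappa>(H).\<close>
    have "v powi (int (kappa_of H A) - int (kappa H)) *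
          v powi (int (total_degree H A) - int (card A)) =
        v powi (int (card (vertices H)) - int (kappa H)) *
          v powi (int (total_degree H A) - int (card A) - int (card (vertices H))
            + int (kappa_of H A))"
      using assms(2) by (simp add: algebra_simps flip: power_int_add)
    from arg_cong[OF this, of "\<lambda>t. q ^ kappa H *
        (q / v) powi (int (kappa_of H A) - int (kappa H)) * t"]
    show ?thesis
      unfolding q_cancel by (simp only: mult_ac)
  qed
  finally show "q ^ kappa_of H A * (\<Prod>e\<in>A. v ^ (hyperdegree H e - 1)) =
      q ^ kappa H * v powi (int (card (vertices H)) - int (kappa H)) *
      ((1 + q / v - 1) powi (int (kappa_of H A) - int (kappa H)) *
       (1 + v - 1) powi (int (total_degree H A) - int (card A) - int (card (vertices H))
         + int (kappa_of H A)))"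
    by simp
qed

text \<open>The embedding \<open>to_fract\<close> is injective, so it suffices to compare
  polynomials. This makes negative powers of \<open>rat_X - 1\<close> genuine inverses.\<close>

lemma rat_X_neq_1: "rat_X \<noteq> 1"
proof -
  have "[:[:0, 1:]:] \<noteq> (1 :: 'k::field poly poly)"
    by (simp add: one_pCons)
  then show ?thesis
    unfolding rat_X_def by (metis to_fract_1 to_fract_eq_iff)
qed

lemma rat_Y_neq_1: "rat_Y \<noteq> 1"
proof -
  have "[:0, 1:] \<noteq> (1 :: 'k::field poly poly)"
    by (simp add: one_pCons)
  then show ?thesis
    unfolding rat_Y_def by (metis to_fract_1 to_fract_eq_iff)
qed

theorem proposition5p6:
  fixes H :: "('v, 'e) hypergraph"
  assumes "is_hypergraph H"
  shows "T_HG H (rat_X :: 'k::field poly poly fract) rat_Y =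
           (rat_X - 1) powi (- int (kappa H)) * (rat_Y - 1) powi (- int (card (vertices H))) *
           Z_RC H ((rat_X - 1) * (rat_Y - 1)) (rat_Y - 1) \<and>
         (\<forall>q v :: 'k. v \<noteq> 0 \<longrightarrow>
            Z_RC H q v =
              q ^ kappa H * v powi (int (card (vertices H)) - int (kappa H)) *
              T_HG H (1 + q / v) (1 + v))"
  \<comment> \<open>The first identity, valid in any field, is taken in the field of rational
    functions at the two indeterminates.\<close>
  using T_HG_eq_Z_RC[OF assms rat_X_neq_1 rat_Y_neq_1] Z_RC_eq_T_HG[OF assms] by blast

end
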